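(* Let $d\ge3$, $p\ge2$, and let $f$ be a non-negative function in $L_p(X_1\times\dots\times X_d,\mu_1\otimes\dots\otimes\mu_d)$. For each integer $M\ge1$ let $Z^+_M[f]$ be a best approximation of $f$ from $D^+[M]$ in $L_p$, with a chosen representation. Then for every integer box $L=\prod_{s=1}^d\{1,\dots,n(s)\}$, $n(s)\ge1$, $$|S_L[f]|_p\le W^{(d)}_L[f](p):=\inf_{M\ge1}\Big[\,|||Z^+_M[f]|||\Theta_{p,L}+Q^+_M[f]_p\,\Big],$$ and $$\sup_L|S_L[f]|_p\le\sup_L W^{(d)}_L[f](p)=:W^{(d)}[f](p),$$ the suprema being over all such boxes.
   Context: $(X_s,\mu_s)$, $s=1,\dots,d$, are probability spaces, $X=\prod_s X_s$. $\xi_i(s)$, $i=1,2,\dots$, $s=1,\dots,d$, are jointly independent random variables, $\xi_i(s)$ being $X_s$-valued with law $\mu_s$. $|\cdot|_p$ denotes the $L_p$ norm of a function or of a random variable. For finite non-empty $L\subset\{1,2,\dots\}^d$ with $|L|$ elements, $S_L[f]=|L|^{-1}\sum_{\vec k\in L}f(\xi_{k(1)}(1),\dots,\xi_{k(d)}(d))$. Bell function: $B(p)=e^{-1}\sum_{k=0}^\infty k^p/k!$. For a sequence $\vec\zeta=(\zeta_j)$ of non-negative independent random variables put $m_j(p)=\mathbf E\zeta_j^p$, $$A_{p,n}[\vec\zeta]=n^{-1}\sum_{j=1}^n m_j(p)^{1/p},\qquad V_{p,n}[\vec\zeta]=n^{-1}B(p)^{1/p}\max\Big\{\Big(\sum_{j=1}^n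 m_j(p)\Big)^{1/p},\ \sum_{j=1}^n m_j(1)\Big\},$$ $\Theta_{p,n}[\vec\zeta]=\min\{A_{p,n}[\vec\zeta],V_{p,n}[\vec\zeta]\}$. For $g\ge0$ on $X_s$, $\Theta_{p,n}[g]:=\Theta_{p,n}[(g(\xi_i(s)))_i]$. For $\vec k=(k(1),\dots,k(d))\in\{1,2,\dots\}^d$ put $N(\vec k)=\max_s k(s)$. For an integer $M\ge1$, $D^+[M]$ is the set of non-negative functions $\tilde f(\vec x)=\sum_{N(\vec k)\le M}\lambda(\vec k)\prod_{s=1}^d g^{(s)}_{k(s)}(x(s))$ with $\lambda(\vec k)\in\mathbb R$ and $0\le g^{(s)}_{k}\in L_p(X_s)$. Given such a representation and the box $L=\prod_s\{1,\dots,n(s)\}$, $$|||\tilde f|||\Theta_{p,L}=\sum_{N(\vec k)\le M}|\lambda(\vec k)|\prod_{s=1}^d\Theta_{p,n(s)}[g^{(s)}_{k(s)}].$$ $Q^+_M[f]_p=\inf_{\tilde f\in D^+[M]}|f-\tilde f|_p$; it is a standing assumption that this infimum is attained for each $M$, and $Z^+_M[f]$ denotes a (not necessarily unique) function in $D^+[M]$ attaining it. *)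

theory Defs
  imports "HOL-Probability.Probability"
begin

text \<open>Conventions: the coordinates \<open>s\<close> range over \<open>{1..d}\<close>; points of the product space and
  multi-indices are extensional functions on \<open>{1..d}\<close>.\<close>

subsection \<open>\<open>L\<^sub>p\<close> norms\<close>

text \<open>The norm takes the value \<open>\<infinity>\<close> exactly when the \<open>p\<close>-th absolute moment is infinite, so an
  upper bound on a norm also asserts finiteness whenever the bound is finite.\<close>

definition Lp_norm :: "'b measure \<Rightarrow> real \<Rightarrow> ('b \<Rightarrow> real) \<Rightarrow> ennreal" where
  "Lp_norm M p h =
     (let I = (\<integral>\<^sup>+ x. ennreal (\<bar>h x\<bar> powr p) \<partial>M)
      in if I = \<infinity> then \<infinity> else ennreal (enn2real I powr (1 / p)))"

definition Lp_funs :: "'b measure \<Rightarrow> real \<Rightarrow> ('b \<Rightarrow> real) set" where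
  "Lp_funs M p = {h \<in> borel_measurable M. Lp_norm M p h < \<infinity>}"

subsection \<open>Bell function and moment bounds\<close>

definition Bell :: "real \<Rightarrow> real" where
  "Bell p = exp (- 1) * (\<Sum>k. real k powr p / fact k)"

text \<open>In the next four definitions \<open>\<zeta> 1, \<zeta> 2, \<dots>\<close> are non-negative random variables on \<open>P\<close>. The
  moments are Bochner integrals and are therefore meaningful for \<open>\<zeta> j\<close> in \<open>L\<^sub>p\<close> with \<open>p \<ge> 1\<close>; this is
  the case in all uses below.\<close>

definition moment :: "'w measure \<Rightarrow> (nat \<Rightarrow> 'w \<Rightarrow> real) \<Rightarrow> nat \<Rightarrow> real \<Rightarrow> real" where
  "moment P \<zeta> j p = (\<integral>\<omega>. \<zeta> j \<omega> powr p \<partial>P)"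

definition A_bound :: "'w measure \<Rightarrow> real \<Rightarrow> nat \<Rightarrow> (nat \<Rightarrow> 'w \<Rightarrow> real) \<Rightarrow> real" where
  "A_bound P p n \<zeta> = (\<Sum>j = 1..n. moment P \<zeta> j p powr (1 / p)) / real n"

definition V_bound :: "'w measure \<Rightarrow> real \<Rightarrow> nat \<Rightarrow> (nat \<Rightarrow> 'w \<Rightarrow> real) \<Rightarrow> real" where
  "V_bound P p n \<zeta> =
     Bell p powr (1 / p) / real n *
     max ((\<Sum>j = 1..n. moment P \<zeta> j p) powr (1 / p)) (\<Sum>j = 1..n. moment P \<zeta> j 1)"

definition Theta :: "'w measure \<Rightarrow> real \<Rightarrow> nat \<Rightarrow> (nat \<Rightarrow> 'w \<Rightarrow> real) \<Rightarrow> real" where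
  "Theta P p n \<zeta> = min (A_bound P p n \<zeta>) (V_bound P p n \<zeta>)"

subsection \<open>Multi-indices, boxes and normalised multi-index sums\<close>

definition multi_indices :: "nat \<Rightarrow> (nat \<Rightarrow> nat) set" where
  "multi_indices d = ({1..d} \<rightarrow>\<^sub>E {1..})"

definition N_max :: "nat \<Rightarrow> (nat \<Rightarrow> nat) \<Rightarrow> nat" where
  "N_max d k = Max (k ` {1..d})"

definition index_box :: "nat \<Rightarrow> (nat \<Rightarrow> nat) \<Rightarrow> (nat \<Rightarrow> nat) set" where
  "index_box d n = (\<Pi>\<^sub>E s\<in>{1..d}. {1..n s})"

text \<open>The random variable \<open>\<xi>\<^sub>i(s)\<close> is \<open>\<xi> i s\<close>.\<close>

definition S_avg ::
    "nat \<Rightarrow> (nat \<Rightarrow> nat \<Rightarrow> 'w \<Rightarrow> 'a) \<Rightarrow> (nat \<Rightarrow> nat) set \<Rightarrow> ((nat \<Rightarrow> 'a) \<Rightarrow> real) \<Rightarrow> 'w \<Rightarrow> real" where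
  "S_avg d \<xi> L f \<omega> = (\<Sum>k\<in>L. f (\<lambda>s\<in>{1..d}. \<xi> (k s) s \<omega>)) / real (card L)"

subsection \<open>Non-negative functions with a degenerate representation\<close>

text \<open>A representation is a pair \<open>(lam, g)\<close> with coefficients \<open>lam k\<close> and factors \<open>g s i\<close> on \<open>X s\<close>.\<close>

definition rep_fun ::
    "nat \<Rightarrow> nat \<Rightarrow> ((nat \<Rightarrow> nat) \<Rightarrow> real) \<Rightarrow> (nat \<Rightarrow> nat \<Rightarrow> 'a \<Rightarrow> real) \<Rightarrow> (nat \<Rightarrow> 'a) \<Rightarrow> real" where
  "rep_fun d M lam g x =
     (\<Sum>k | k \<in> multi_indices d \<and> N_max d k \<le> M. lam k * (\<Prod>s = 1..d. g s (k s) (x s)))"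

definition D_plus_rep ::
    "(nat \<Rightarrow> 'a measure) \<Rightarrow> nat \<Rightarrow> real \<Rightarrow> nat \<Rightarrow>
     ((nat \<Rightarrow> nat) \<Rightarrow> real) \<Rightarrow> (nat \<Rightarrow> nat \<Rightarrow> 'a \<Rightarrow> real) \<Rightarrow> bool" where
  "D_plus_rep X d p M lam g \<longleftrightarrow>
     (\<forall>s\<in>{1..d}. \<forall>i\<in>{1..M}. g s i \<in> Lp_funs (X s) p \<and> (\<forall>y\<in>space (X s). 0 \<le> g s i y)) \<and>
     (\<forall>x\<in>space (PiM {1..d} X). 0 \<le> rep_fun d M lam g x)"

definition D_plus :: "(nat \<Rightarrow> 'a measure) \<Rightarrow> nat \<Rightarrow> real \<Rightarrow> nat \<Rightarrow> ((nat \<Rightarrow> 'a) \<Rightarrow> real) set" where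
  "D_plus X d p M = {rep_fun d M lam g |lam g. D_plus_rep X d p M lam g}"

definition Q_plus ::
    "(nat \<Rightarrow> 'a measure) \<Rightarrow> nat \<Rightarrow> real \<Rightarrow> nat \<Rightarrow> ((nat \<Rightarrow> 'a) \<Rightarrow> real) \<Rightarrow> ennreal" where
  "Q_plus X d p M f = (INF h\<in>D_plus X d p M. Lp_norm (PiM {1..d} X) p (\<lambda>x. f x - h x))"

text \<open>\<open>rep_fun d M lam g\<close> is a best approximation \<open>Z\<^sup>+\<^sub>M[f]\<close>, with chosen representation \<open>(lam, g)\<close>.\<close>

definition is_Z_plus ::
    "(nat \<Rightarrow> 'a measure) \<Rightarrow> nat \<Rightarrow> real \<Rightarrow> nat \<Rightarrow> ((nat \<Rightarrow> 'a) \<Rightarrow> real) \<Rightarrow>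
     ((nat \<Rightarrow> nat) \<Rightarrow> real) \<Rightarrow> (nat \<Rightarrow> nat \<Rightarrow> 'a \<Rightarrow> real) \<Rightarrow> bool" where
  "is_Z_plus X d p M f lam g \<longleftrightarrow>
     D_plus_rep X d p M lam g \<and>
     Lp_norm (PiM {1..d} X) p (\<lambda>x. f x - rep_fun d M lam g x) = Q_plus X d p M f"

text \<open>The quantity \<open>|||\<cdot>|||\<Theta>\<^bsub>p,L\<^esub>\<close> for \<open>L = index_box d n\<close>; it depends on the representation.\<close>

definition triple_Theta ::
    "'w measure \<Rightarrow> (nat \<Rightarrow> nat \<Rightarrow> 'w \<Rightarrow> 'a) \<Rightarrow> nat \<Rightarrow> real \<Rightarrow> (nat \<Rightarrow> nat) \<Rightarrow> nat \<Rightarrow>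
     ((nat \<Rightarrow> nat) \<Rightarrow> real) \<Rightarrow> (nat \<Rightarrow> nat \<Rightarrow> 'a \<Rightarrow> real) \<Rightarrow> real" where
  "triple_Theta P \<xi> d p n M lam g =
     (\<Sum>k | k \<in> multi_indices d \<and> N_max d k \<le> M.
        \<bar>lam k\<bar> * (\<Prod>s = 1..d. Theta P p (n s) (\<lambda>j \<omega>. g s (k s) (\<xi> j s \<omega>))))"

subsection \<open>The bounds \<open>W\<close>\<close>

text \<open>Here \<open>lam M\<close>, \<open>g M\<close> is the chosen representation of the best approximation \<open>Z\<^sup>+\<^sub>M[f]\<close>.\<close>

definition W_box ::
    "(nat \<Rightarrow> 'a measure) \<Rightarrow> 'w measure \<Rightarrow> (nat \<Rightarrow> nat \<Rightarrow> 'w \<Rightarrow> 'a) \<Rightarrow> nat \<Rightarrow> real \<Rightarrow> ((nat \<Rightarrow> 'a) \<Rightarrow> real) \<Rightarrow>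
     (nat \<Rightarrow> (nat \<Rightarrow> nat) \<Rightarrow> real) \<Rightarrow> (nat \<Rightarrow> nat \<Rightarrow> nat \<Rightarrow> 'a \<Rightarrow> real) \<Rightarrow> (nat \<Rightarrow> nat) \<Rightarrow> ennreal" where
  "W_box X P \<xi> d p f lam g n =
     (INF M\<in>{1..}. ennreal (triple_Theta P \<xi> d p n M (lam M) (g M)) + Q_plus X d p M f)"

definition W_sup ::
    "(nat \<Rightarrow> 'a measure) \<Rightarrow> 'w measure \<Rightarrow> (nat \<Rightarrow> nat \<Rightarrow> 'w \<Rightarrow> 'a) \<Rightarrow> nat \<Rightarrow> real \<Rightarrow> ((nat \<Rightarrow> 'a) \<Rightarrow> real) \<Rightarrow>
     (nat \<Rightarrow> (nat \<Rightarrow> nat) \<Rightarrow> real) \<Rightarrow> (nat \<Rightarrow> nat \<Rightarrow> nat \<Rightarrow> 'a \<Rightarrow> real) \<Rightarrow> ennreal" where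
  "W_sup X P \<xi> d p f lam g =
     (SUP n\<in>{n. \<forall>s\<in>{1..d}. 1 \<le> n s}. W_box X P \<xi> d p f lam g n)"

end

theory Submission
  imports Defs "HOL-Real_Asymp.Real_Asymp"
begin

text \<open>
  Split \<open>S\<^sub>L[f] = S\<^sub>L[Z] + S\<^sub>L[f - Z]\<close>. The second term is an average of copies of \<open>f - Z\<close>, so its
  norm is at most \<open>Q\<close>. In the first one each product term factors into \<open>d\<close> independent averages of
  i.i.d. variables, and each factor is bounded by \<open>\<Theta>\<close>: by Minkowski's inequality for \<open>A\<close>, and by
  Rosenthal's inequality with the sharp constant \<open>B(p)\<close> for \<open>V\<close>.

  The latter rests on a pointwise estimate: for \<open>p \<ge> 2\<close>, \<open>x \<ge> 0\<close>, \<open>t > 0\<close> there are \<open>A, C \<ge> 0\<close> with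
  \<open>(x + u)\<^sup>p \<le> x\<^sup>p + A u + C u\<^sup>p\<close> for all \<open>u \<ge> 0\<close> and equality at \<open>u = t\<close>. With
  \<open>t = max {(n m(p))\<^bsup>1/p\<^esup>, n m(1)}\<close> it shows that one summand may be replaced by \<open>t\<close> times a
  Bernoulli variable of mean \<open>1/n\<close>, and by convexity by \<open>t\<close> times a Poisson variable of rate
  \<open>1/n\<close>. After \<open>n\<close> replacements the sum has become \<open>t\<close> times a Poisson variable of rate 1, whose
  \<open>p\<close>-th moment is \<open>B(p) t\<^sup>p\<close>.
\<close>

subsection \<open>A tangent majorant for shifted powers\<close>

text \<open>If one endpoint is 0, the inequality reduces to \<open>a powr q \<le> a\<close> for
  \<open>0 < a < 1\<close>. The closed half-line matters because zero shifts and zero function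
  values occur below.\<close>

lemma convex_on_powr:
  fixes q :: real
  assumes "1 \<le> q"
  shows "convex_on {0..} (\<lambda>x. x powr q)"
proof (rule convex_onI)
  have z: "(a * y) powr q \<le> a * y powr q" if "0 < a" "a < 1" "0 \<le> y" for a y :: real
  proof -
    have "a powr q \<le> a" using that assms powr_mono'[of 1 q a] by simp
    then show ?thesis using that by (simp add: powr_mult mult_right_mono)
  qed
  fix t x y :: real
  assume t: "0 < t" "t < 1" and xy: "x \<in> {0..}" "y \<in> {0..}"
  show "((1 - t) *\<^sub>R x + t *\<^sub>R y) powr q \<le> (1 - t) * x powr q + t * y powr q"
  proof (cases "x = 0 \<or> y = 0")
    case True
    then show ?thesis using z[of t y] z[of "1 - t" x] t xy assms by auto
  next
    case False
    then show ?thesis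
      using t xy by (intro convex_onD[OF powr_convex[OF assms]]) auto
  qed
qed simp

text \<open>By the mean value theorem the difference equals a derivative at a point below
  \<open>1 + y\<close>. This decides the sign of the intercept \<open>C\<close> in
  \<open>powr_majorant_unit\<close>.\<close>

lemma powr_diff_le:
  fixes q y :: real
  assumes "1 \<le> q" "0 \<le> y"
  shows "(1 + y) powr q - y powr q \<le> q * (1 + y) powr (q - 1)"
proof (cases "y = 0")
  case False
  then have "\<exists>z. y < z \<and> z < 1 + y \<and>
      (1 + y) powr q - y powr q = (1 + y - y) * (q * z powr (q - 1))"
    using assms by (intro MVT2) (auto intro!: DERIV_powr derivative_eq_intros)
  then obtain z where z: "y < z" "z < 1 + y" "(1 + y) powr q - y powr q = q * z powr (q - 1)"
    by auto
  have "z powr (q - 1) \<le> (1 + y) powr (q - 1)"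
    using z assms by (intro powr_mono2) auto
  with z assms show ?thesis by (simp add: mult_left_mono)
qed (use assms in simp)

text \<open>Convexity, as \<open>1 + v\<close> is the convex combination of \<open>1\<close> and
  \<open>1 + w\<close> with weight \<open>v / w\<close>: both sides are slopes of chords starting at
  1.\<close>

lemma powr_chord_mono:
  fixes q v w :: real
  assumes "1 \<le> q" "0 < v" "v \<le> w"
  shows "((1 + v) powr q - 1) / v \<le> ((1 + w) powr q - 1) / w"
proof -
  let ?l = "v / w"
  have l: "0 \<le> ?l" "?l \<le> 1" using assms by (auto simp: field_simps)
  have "convex_on {0..} (\<lambda>x::real. x powr q)"
    using assms by (intro convex_on_powr)
  then have "((1 - ?l) *\<^sub>R 1 + ?l *\<^sub>R (1 + w)) powr q
      \<le> (1 - ?l) * 1 powr q + ?l * (1 + w) powr q"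
    using assms l by (intro convex_onD) auto
  moreover have "(1 - ?l) *\<^sub>R 1 + ?l *\<^sub>R (1 + w) = 1 + v"
    using assms by (simp add: field_simps)
  ultimately have "(1 + v) powr q - 1 \<le> ?l * ((1 + w) powr q - 1)"
    by (simp add: algebra_simps)
  then show ?thesis using assms by (simp add: field_simps)
qed

text \<open>As a function of \<open>z = y powr (p - 1)\<close>, the function \<open>(1 + y) powr p - y powr p\<close> is concave,
  and \<open>C + A * z\<close> is its tangent at \<open>y0\<close>.\<close>
lemma powr_majorant_unit:
  fixes p y0 :: real
  assumes "2 \<le> p" "0 < y0"
  obtains A C where "0 \<le> A" "0 \<le> C" "C + A * y0 powr (p - 1) = (1 + y0) powr p - y0 powr p"
    "\<And>y. 0 < y \<Longrightarrow> (1 + y) powr p - y powr p \<le> C + A * y powr (p - 1)"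
proof -
  \<comment> \<open>\<open>s y\<close> is the derivative of \<open>(1 + y) powr p - y powr p\<close>
    with respect to \<open>y powr (p - 1)\<close>, written as the chord slope of the power
    \<open>p - 1\<close> between \<open>1\<close> and \<open>1 + 1 / y\<close>. As
    \<open>p - 1 \<ge> 1\<close>, it does not increase with \<open>y\<close>.\<close>
  define s where "s y = p / (p - 1) * (((1 + 1 / y) powr (p - 1) - 1) / (1 / y))" for y :: real
  define A where "A = s y0"
  \<comment> \<open>The intercept of the tangent at \<open>y0\<close>, simplified to a form whose
    sign follows from \<open>powr_diff_le\<close>.\<close>
  define C where "C = (p * (1 + y0) powr (p - 1) - ((1 + y0) powr p - y0 powr p)) / (p - 1)"
  define D where "D y = C + A * y powr (p - 1) - ((1 + y) powr p - y powr p)" for y :: real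
  have s_anti: "s z \<le> s y" if "0 < y" "y \<le> z" for y z
    unfolding s_def using assms that
    by (intro mult_left_mono powr_chord_mono) (auto simp: field_simps)
  have s_eq: "s y * (p - 1) * y powr (p - 2) = p * ((1 + y) powr (p - 1) - y powr (p - 1))"
    if "0 < y" for y
  proof -
    have 1: "(1 + 1 / y) powr (p - 1) * y powr (p - 1) = (1 + y) powr (p - 1)"
      using that by (simp add: distrib_right add.commute flip: powr_mult)
    have 2: "y powr (p - 1) = y * y powr (p - 2)"
      using that by (simp add: powr_mult_base)
    have "s y * (p - 1) * y powr (p - 2) = p * (((1 + 1 / y) powr (p - 1) - 1) * (y * y powr (p - 2)))"
      using assms that by (simp add: s_def field_simps)
    also have "\<dots> = p * ((1 + y) powr (p - 1) - y powr (p - 1))"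
      using 1 2 by (simp add: algebra_simps)
    finally show ?thesis .
  qed
  have D_deriv: "(D has_real_derivative (A - s y) * (p - 1) * y powr (p - 2)) (at y)" if "0 < y" for y
  proof -
    have "(D has_real_derivative A * ((p - 1) * y powr (p - 1 - 1)) -
        (p * (1 + y) powr (p - 1) - p * y powr (p - 1))) (at y)"
      unfolding D_def using that by (auto intro!: derivative_eq_intros)
    also have "A * ((p - 1) * y powr (p - 1 - 1)) - (p * (1 + y) powr (p - 1) - p * y powr (p - 1))
        = (A - s y) * (p - 1) * y powr (p - 2)"
      using s_eq[OF that] by (simp add: algebra_simps)
    finally show ?thesis .
  qed
  have C0: "0 \<le> C"
    using powr_diff_le[of p y0] assms by (simp add: C_def)
  have A0: "0 \<le> A"
    unfolding A_def s_def using assms by (auto intro!: mult_nonneg_nonneg divide_nonneg_nonneg ge_one_powr_ge_zero)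
  \<comment> \<open>Contact at \<open>y0\<close>; the factor \<open>p - 1\<close> clears the
    denominators of \<open>A\<close> and \<open>C\<close>.\<close>
  have "D y0 * (p - 1) = 0"
  proof -
    have 1: "y0 powr (p - 1) = y0 * y0 powr (p - 2)"
      using assms by (simp add: powr_mult_base)
    have 2: "y0 powr p = y0 * y0 powr (p - 1)" "(1 + y0) powr p = (1 + y0) * (1 + y0) powr (p - 1)"
      using assms by (simp_all add: powr_mult_base)
    have "(p - 1) * (A * y0 powr (p - 1)) = y0 * (s y0 * (p - 1) * y0 powr (p - 2))"
      by (simp add: A_def 1)
    also have "\<dots> = y0 * (p * ((1 + y0) powr (p - 1) - y0 powr (p - 1)))"
      using s_eq[of y0] assms by simp
    finally have "(p - 1) * (A * y0 powr (p - 1)) = y0 * (p * ((1 + y0) powr (p - 1) - y0 powr (p - 1)))" .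
    moreover have "C * (p - 1) = p * (1 + y0) powr (p - 1) - ((1 + y0) powr p - y0 powr p)"
      using assms by (simp add: C_def)
    ultimately have "D y0 * (p - 1) = p * (1 + y0) powr (p - 1) - ((1 + y0) powr p - y0 powr p)
       + y0 * (p * ((1 + y0) powr (p - 1) - y0 powr (p - 1))) - (p - 1) * ((1 + y0) powr p - y0 powr p)"
      by (simp add: D_def algebra_simps)
    also have "\<dots> = 0" unfolding 2 by (simp add: algebra_simps)
    finally show ?thesis .
  qed
  then have D0: "D y0 = 0" using assms by simp
  \<comment> \<open>The derivative of \<open>D\<close> has the sign of \<open>A - s y\<close>, so
    \<open>D\<close> falls up to \<open>y0\<close>, rises afterwards, and has its minimum 0
    there.\<close>
  have D_nonneg: "0 \<le> D y" if "0 < y" for y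
  proof (cases "y \<le> y0")
    case True
    have "D y0 \<le> D y"
    proof (rule DERIV_nonpos_imp_nonincreasing[OF True])
      fix z assume "y \<le> z" "z \<le> y0"
      then show "\<exists>d. (D has_real_derivative d) (at z) \<and> d \<le> 0"
        using D_deriv[of z] s_anti[of z y0] assms that
        by (intro exI[of _ "(A - s z) * (p - 1) * z powr (p - 2)"])
           (auto simp: A_def intro!: mult_nonpos_nonneg)
    qed
    with D0 show ?thesis by simp
  next
    case False
    have "D y0 \<le> D y"
    proof (rule DERIV_nonneg_imp_nondecreasing[where f = D])
      show "y0 \<le> y" using False by simp
      fix z assume "y0 \<le> z" "z \<le> y"
      then show "\<exists>d. (D has_real_derivative d) (at z) \<and> 0 \<le> d"
        using D_deriv[of z] s_anti[of y0 z] assms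
        by (intro exI[of _ "(A - s z) * (p - 1) * z powr (p - 2)"])
           (auto simp: A_def intro!: mult_nonneg_nonneg)
    qed
    with D0 show ?thesis by simp
  qed
  show thesis
    by (rule that[OF A0 C0]) (use D0 D_nonneg in \<open>auto simp: D_def algebra_simps\<close>)
qed

text \<open>Homogeneity: multiplying the unit estimate at \<open>y = x / u\<close> by
  \<open>u powr p\<close> turns its intercept into the coefficient of \<open>u powr p\<close> and
  its slope, times \<open>x powr (p - 1)\<close>, into the coefficient of \<open>u\<close>. Contact
  at \<open>u = t\<close> means \<open>y0 = x / t\<close>.\<close>

lemma powr_majorant:
  fixes p x t :: real
  assumes "2 \<le> p" "0 \<le> x" "0 < t"
  obtains A C where "0 \<le> A" "0 \<le> C" "x powr p + A * t + C * t powr p = (x + t) powr p"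
    "\<And>u. 0 \<le> u \<Longrightarrow> (x + u) powr p \<le> x powr p + A * u + C * u powr p"
proof (cases "x = 0")
  case True
  with assms show ?thesis by (intro that[of 0 1]) auto
next
  case False
  with assms have x: "0 < x" by simp
  have scale: "(1 + x / u) powr p * u powr p = (x + u) powr p"
       "(x / u) powr p * u powr p = x powr p"
       "(x / u) powr (p - 1) * u powr p = x powr (p - 1) * u" if "0 < u" for u
  proof -
    show "(1 + x / u) powr p * u powr p = (x + u) powr p"
      using that x by (simp add: distrib_right add.commute flip: powr_mult)
    show "(x / u) powr p * u powr p = x powr p"
      using that x by (simp add: distrib_right add.commute flip: powr_mult)
    have "(x / u) powr (p - 1) * u powr p = ((x / u) powr (p - 1) * u powr (p - 1)) * u"
      using that powr_mult_base[of u "p - 1"] by (simp add: mult.commute mult.left_commute)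
    also have "(x / u) powr (p - 1) * u powr (p - 1) = x powr (p - 1)"
      using that x by (simp add: distrib_right add.commute flip: powr_mult)
    finally show "(x / u) powr (p - 1) * u powr p = x powr (p - 1) * u" .
  qed
  obtain A C where AC: "0 \<le> A" "0 \<le> C"
    "C + A * (x / t) powr (p - 1) = (1 + x / t) powr p - (x / t) powr p"
    "\<And>y. 0 < y \<Longrightarrow> (1 + y) powr p - y powr p \<le> C + A * y powr (p - 1)"
    using powr_majorant_unit[of p "x / t"] assms x by (metis divide_pos_pos)
  show ?thesis
  proof (rule that[of "A * x powr (p - 1)" C])
    have "(C + A * (x / t) powr (p - 1)) * t powr p = (1 + x / t) powr p * t powr p - (x / t) powr p * t powr p"
      unfolding AC(3) by (simp add: algebra_simps)
    then show "x powr p + A * x powr (p - 1) * t + C * t powr p = (x + t) powr p"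
      using scale[of t] assms by (simp add: algebra_simps)
  next
    fix u :: real assume u: "0 \<le> u"
    show "(x + u) powr p \<le> x powr p + A * x powr (p - 1) * u + C * u powr p"
    proof (cases "u = 0")
      case False
      with u have u: "0 < u" by simp
      then have "((1 + x / u) powr p - (x / u) powr p) * u powr p \<le> (C + A * (x / u) powr (p - 1)) * u powr p"
        using AC(4)[of "x / u"] x by (intro mult_right_mono) auto
      then show ?thesis
        using scale[OF u] by (simp add: algebra_simps)
    qed simp
  qed (use AC in auto)
qed

subsection \<open>Rosenthal's inequality by comparison with a Poisson variable\<close>

text \<open>The convolution sum collapses by the binomial theorem. The \<open>bind_pmf\<close> form
  unfolds directly into the iterated integrals of the induction on the number of summands.\<close>

lemma poisson_convolution:
  fixes a b :: real
  assumes "0 < a" "0 < b"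
  shows "bind_pmf (poisson_pmf a) (\<lambda>k. map_pmf ((+) k) (poisson_pmf b)) = poisson_pmf (a + b)"
proof (rule pmf_eqI)
  fix n :: nat
  have map: "pmf (map_pmf ((+) k) (poisson_pmf b)) n = (if k \<le> n then pmf (poisson_pmf b) (n - k) else 0)" for k
  proof (cases "k \<le> n")
    case True
    then show ?thesis using pmf_map_inj'[of "(+) k" "poisson_pmf b" "n - k"] by simp
  next
    case False
    then show ?thesis by (auto intro!: pmf_map_outside)
  qed
  have "pmf (bind_pmf (poisson_pmf a) (\<lambda>k. map_pmf ((+) k) (poisson_pmf b))) n
      = (\<integral>k. (if k \<le> n then pmf (poisson_pmf b) (n - k) else 0) \<partial>measure_pmf (poisson_pmf a))"
    unfolding pmf_bind map ..
  also have "\<dots> = (\<Sum>k\<le>n. pmf (poisson_pmf a) k * pmf (poisson_pmf b) (n - k))"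
    by (subst integral_measure_pmf[of "{..n}"]) (auto intro!: sum.cong split: if_splits)
  also have "\<dots> = (\<Sum>k\<le>n. of_nat (n choose k) * a ^ k * b ^ (n - k) / fact n * exp (- (a + b)))"
    using assms by (intro sum.cong refl) (simp add: binomial_fact exp_add[symmetric] field_simps)
  also have "\<dots> = (a + b) ^ n / fact n * exp (- (a + b))"
    by (simp add: binomial_ring sum_distrib_right sum_divide_distrib)
  finally show "pmf (bind_pmf (poisson_pmf a) (\<lambda>k. map_pmf ((+) k) (poisson_pmf b))) n
      = pmf (poisson_pmf (a + b)) n"
    using assms by simp
qed

lemma nn_integral_poisson_add:
  fixes a b :: real and h :: "nat \<Rightarrow> ennreal"
  assumes "0 < a" "0 < b"
  shows "(\<integral>\<^sup>+k. \<integral>\<^sup>+j. h (k + j) \<partial>poisson_pmf b \<partial>poisson_pmf a) = (\<integral>\<^sup>+k. h k \<partial>poisson_pmf (a + b))"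
  by (simp flip: poisson_convolution[OF assms])

lemma nn_integral_poisson_eq_suminf:
  fixes r :: real
  assumes "0 < r" "\<And>k. 0 \<le> h k"
  shows "(\<integral>\<^sup>+k. ennreal (h k) \<partial>poisson_pmf r) = (\<Sum>k. ennreal (exp (- r) * (r ^ k / fact k * h k)))"
  using assms
  by (simp add: nn_integral_measure_pmf nn_integral_count_space_nat mult_ac flip: ennreal_mult)

lemma poisson_mean:
  fixes r :: real
  assumes "0 < r"
  shows "(\<integral>\<^sup>+k. ennreal (real k) \<partial>poisson_pmf r) = ennreal r"
proof -
  have "(\<lambda>k. r ^ k / fact k) sums exp r"
    using exp_converges[of r] by (simp add: field_simps)
  then have "(\<lambda>k. exp (- r) * r * (r ^ k / fact k)) sums (exp (- r) * r * exp r)"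
    by (rule sums_mult)
  moreover have "exp (- r) * r * (r ^ k / fact k) = exp (- r) * (r ^ Suc k / fact (Suc k) * real (Suc k))" for k
    by (simp add: field_simps del: of_nat_Suc)
  moreover have "exp (- r) * r * exp r = r"
    by (simp add: exp_minus)
  ultimately have "(\<lambda>k. exp (- r) * (r ^ Suc k / fact (Suc k) * real (Suc k))) sums r"
    by (simp only:)
  \<comment> \<open>Undoes the index shift; the added term at \<open>k = 0\<close> is 0.\<close>
  then have "(\<lambda>k. exp (- r) * (r ^ k / fact k * real k)) sums r"
    by (subst (asm) sums_Suc_iff) simp
  then show ?thesis
    using assms by (subst nn_integral_poisson_eq_suminf) (auto intro!: suminf_ennreal_eq)
qed

text \<open>\<open>real k powr p\<close> is of order at most \<open>2 ^ k\<close>, so the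
  exponential series at 2 dominates. Hence the series in \<open>Bell\<close> is a genuine
  sum.\<close>

lemma summable_powr_div_fact: "summable (\<lambda>k. real k powr p / fact k)"
proof (rule summable_comparison_test_bigo)
  show "summable (\<lambda>k. norm (2 ^ k / fact k :: real))"
    using summable_exp[of 2] by (simp add: field_simps)
  have "(\<lambda>k. real k powr p) \<in> O(\<lambda>k. 2 ^ k)" by real_asymp
  then show "(\<lambda>k. real k powr p / fact k) \<in> O(\<lambda>k. 2 ^ k / fact k)"
    by (intro landau_o.big.divide_right) (auto intro: always_eventually)
qed

lemma Bell_nonneg: "0 \<le> Bell p"
  unfolding Bell_def by (intro mult_nonneg_nonneg suminf_nonneg summable_powr_div_fact) auto

text \<open>The weights \<open>exp (- 1) / fact k\<close> in \<open>Bell\<close> are the masses of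
  the Poisson law of rate 1; this is the source of the constant in \<open>V_bound\<close>.\<close>

lemma Bell_eq_poisson_moment: "(\<integral>\<^sup>+k. ennreal (real k powr p) \<partial>poisson_pmf 1) = ennreal (Bell p)"
proof -
  have "(\<lambda>k. exp (- 1) * (real k powr p / fact k)) sums Bell p"
    unfolding Bell_def by (intro sums_mult summable_sums summable_powr_div_fact)
  then show ?thesis
    by (subst nn_integral_poisson_eq_suminf) (auto intro!: suminf_ennreal_eq)
qed

section \<open>Replacing summands by Poisson variables\<close>

text \<open>By convexity, \<open>(x + k * t) powr p\<close> lies at every natural \<open>k\<close>
  on or above the line through its values at 0 and 1; integrating that line uses only the mean
  \<open>r\<close>. For \<open>r \<le> 1\<close> the left side is the moment for \<open>t\<close>
  times a Bernoulli variable of mean \<open>r\<close>.\<close>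

lemma poisson_powr_lower:
  fixes p r t x :: real
  assumes "1 \<le> p" "0 < r" "0 \<le> t" "0 \<le> x"
  shows "ennreal (x powr p + r * ((x + t) powr p - x powr p))
    \<le> (\<integral>\<^sup>+k. ennreal ((x + real k * t) powr p) \<partial>poisson_pmf r)"
proof -
  let ?d = "(x + t) powr p - x powr p"
  have d: "0 \<le> ?d" using assms by (auto intro!: powr_mono2)
  have "x powr p + real k * ?d \<le> (x + real k * t) powr p" for k
  proof (cases "k = 0")
    case False
    \<comment> \<open>\<open>x + t\<close> divides the segment from \<open>x\<close> to
      \<open>x + k * t\<close> with weight \<open>1 / k\<close>; solving for the far endpoint gives
      the line.\<close>
    have "((1 - 1 / real k) *\<^sub>R x + (1 / real k) *\<^sub>R (x + real k * t)) powr p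
        \<le> (1 - 1 / real k) * x powr p + (1 / real k) * (x + real k * t) powr p"
      using False assms by (intro convex_onD[OF convex_on_powr]) auto
    moreover have "(1 - 1 / real k) *\<^sub>R x + (1 / real k) *\<^sub>R (x + real k * t) = x + t"
      using False by (simp add: field_simps)
    ultimately have "real k * (x + t) powr p
        \<le> real k * ((1 - 1 / real k) * x powr p + (1 / real k) * (x + real k * t) powr p)"
      by (intro mult_left_mono) auto
    also have "\<dots> = (real k - 1) * x powr p + (x + real k * t) powr p"
      using False by (simp add: field_simps)
    finally show ?thesis by (simp add: algebra_simps)
  qed simp
  then have "(\<integral>\<^sup>+k. ennreal (x powr p + real k * ?d) \<partial>poisson_pmf r)
      \<le> (\<integral>\<^sup>+k. ennreal ((x + real k * t) powr p) \<partial>poisson_pmf r)"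
    by (intro nn_integral_mono ennreal_leI)
  moreover have "(\<integral>\<^sup>+k. ennreal (x powr p + real k * ?d) \<partial>poisson_pmf r)
      = ennreal (x powr p) + ennreal r * ennreal ?d"
    using d assms
    by (simp add: ennreal_mult nn_integral_add nn_integral_multc poisson_mean)
  ultimately show ?thesis
    using d assms by (simp add: ennreal_mult)
qed

text \<open>The exchange of one summand. Integrating the majorant that touches at \<open>t\<close>
  leaves only the two bounded moments, with coefficients \<open>A\<close> and \<open>C\<close> of
  the right sign; equality at \<open>t\<close> turns the result into the left side of
  \<open>poisson_powr_lower\<close>.\<close>

lemma (in prob_space) nn_integral_shift_powr_le:
  fixes p r t x :: real and g :: "'a \<Rightarrow> real"
  assumes "2 \<le> p" "0 < r" "0 < t" "0 \<le> x"
    and g: "g \<in> borel_measurable M" "\<And>y. y \<in> space M \<Longrightarrow> 0 \<le> g y"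
    and m1: "(\<integral>\<^sup>+y. ennreal (g y) \<partial>M) \<le> ennreal (r * t)"
    and mp: "(\<integral>\<^sup>+y. ennreal (g y powr p) \<partial>M) \<le> ennreal (r * t powr p)"
  shows "(\<integral>\<^sup>+y. ennreal ((x + g y) powr p) \<partial>M)
    \<le> (\<integral>\<^sup>+k. ennreal ((x + real k * t) powr p) \<partial>poisson_pmf r)"
proof -
  obtain A C where AC: "0 \<le> A" "0 \<le> C" "x powr p + A * t + C * t powr p = (x + t) powr p"
    "\<And>u. 0 \<le> u \<Longrightarrow> (x + u) powr p \<le> x powr p + A * u + C * u powr p"
    using powr_majorant[of p x t] assms by metis
  have "(\<integral>\<^sup>+y. ennreal ((x + g y) powr p) \<partial>M)
      \<le> (\<integral>\<^sup>+y. ennreal (x powr p) + ennreal A * ennreal (g y) + ennreal C * ennreal (g y powr p) \<partial>M)"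
    using AC g by (intro nn_integral_mono) (auto simp flip: ennreal_mult ennreal_plus)
  also have "\<dots> = ennreal (x powr p) + ennreal A * (\<integral>\<^sup>+y. ennreal (g y) \<partial>M)
      + ennreal C * (\<integral>\<^sup>+y. ennreal (g y powr p) \<partial>M)"
    using g by (simp add: nn_integral_add nn_integral_cmult emeasure_space_1)
  also have "\<dots> \<le> ennreal (x powr p) + ennreal A * ennreal (r * t) + ennreal C * ennreal (r * t powr p)"
    by (intro add_mono mult_left_mono m1 mp) auto
  also have "\<dots> = ennreal (x powr p + r * (A * t + C * t powr p))"
    using AC assms by (simp add: algebra_simps flip: ennreal_mult ennreal_plus)
  also have "A * t + C * t powr p = (x + t) powr p - x powr p"
    using AC by simp
  also have "ennreal (x powr p + r * ((x + t) powr p - x powr p))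
    \<le> (\<integral>\<^sup>+k. ennreal ((x + real k * t) powr p) \<partial>poisson_pmf r)"
    using assms by (intro poisson_powr_lower) auto
  finally show ?thesis .
qed

text \<open>Exchange the summands one at a time. The shift \<open>x\<close> stays arbitrary in the
  induction since it holds the summand fixed at that moment, and the base case is a singleton so
  that all Poisson rates are positive.\<close>

lemma (in prob_space) iid_sum_powr_le_poisson:
  fixes p r t x :: real and g :: "'a \<Rightarrow> real" and I :: "'i set"
  assumes p: "2 \<le> p" and r: "0 < r" and t: "0 < t"
    and g [measurable]: "g \<in> borel_measurable M" and g0: "\<And>y. y \<in> space M \<Longrightarrow> 0 \<le> g y"
    and m1: "(\<integral>\<^sup>+y. ennreal (g y) \<partial>M) \<le> ennreal (r * t)"
    and mp: "(\<integral>\<^sup>+y. ennreal (g y powr p) \<partial>M) \<le> ennreal (r * t powr p)"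
    and "finite I" "I \<noteq> {}" "0 \<le> x"
  shows "(\<integral>\<^sup>+w. ennreal ((x + (\<Sum>i\<in>I. g (w i))) powr p) \<partial>PiM I (\<lambda>_. M))
    \<le> (\<integral>\<^sup>+k. ennreal ((x + real k * t) powr p) \<partial>poisson_pmf (real (card I) * r))"
  using assms(8-)
proof (induction I arbitrary: x rule: finite_ne_induct)
  case (singleton i)
  interpret product_sigma_finite "\<lambda>_::'i. M"
    by unfold_locales
  have "(\<integral>\<^sup>+w. ennreal ((x + (\<Sum>i\<in>{i}. g (w i))) powr p) \<partial>PiM {i} (\<lambda>_. M))
      = (\<integral>\<^sup>+y. ennreal ((x + g y) powr p) \<partial>M)"
    using product_nn_integral_singleton[of "\<lambda>y. ennreal ((x + g y) powr p)" i] by simp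
  also have "\<dots> \<le> (\<integral>\<^sup>+k. ennreal ((x + real k * t) powr p) \<partial>poisson_pmf r)"
    using singleton assms by (intro nn_integral_shift_powr_le) auto
  finally show ?case by simp
next
  case (insert i I)
  interpret product_sigma_finite "\<lambda>_::'i. M"
    by unfold_locales
  have I: "0 < real (card I) * r" using insert r by (simp add: card_gt_0_iff)
  have sum: "(\<Sum>j\<in>insert i I. g ((w(i := y)) j)) = g y + (\<Sum>j\<in>I. g (w j))" for w y
  proof -
    have "(\<Sum>j\<in>I. g ((w(i := y)) j)) = (\<Sum>j\<in>I. g (w j))"
      using insert by (intro sum.cong) auto
    then show ?thesis using insert by simp
  qed
  have "(\<integral>\<^sup>+w. ennreal ((x + (\<Sum>j\<in>insert i I. g (w j))) powr p) \<partial>PiM (insert i I) (\<lambda>_. M))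
      = (\<integral>\<^sup>+y. \<integral>\<^sup>+w. ennreal (((x + g y) + (\<Sum>j\<in>I. g (w j))) powr p) \<partial>PiM I (\<lambda>_. M) \<partial>M)"
    using insert by (subst product_nn_integral_insert_rev) (auto simp: sum add.assoc simp del: fun_upd_apply)
  also have "\<dots> \<le> (\<integral>\<^sup>+y. \<integral>\<^sup>+k. ennreal (((x + g y) + real k * t) powr p) \<partial>poisson_pmf (real (card I) * r) \<partial>M)"
    using insert g0 by (intro nn_integral_mono insert.IH) auto
  \<comment> \<open>Tonelli, with the Poisson integral written as a series. The Poisson value
    becomes part of the shift, and the remaining summand can be exchanged.\<close>
  also have "\<dots> = (\<integral>\<^sup>+k. \<integral>\<^sup>+y. ennreal (((x + real k * t) + g y) powr p) \<partial>M \<partial>poisson_pmf (real (card I) * r))"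
    by (simp add: nn_integral_measure_pmf nn_integral_count_space_nat nn_integral_suminf
        nn_integral_cmult add_ac)
  also have "\<dots> \<le> (\<integral>\<^sup>+k. \<integral>\<^sup>+j. ennreal (((x + real k * t) + real j * t) powr p) \<partial>poisson_pmf r
      \<partial>poisson_pmf (real (card I) * r))"
    using insert assms by (intro nn_integral_mono nn_integral_shift_powr_le) auto
  also have "\<dots> = (\<integral>\<^sup>+k. ennreal ((x + real k * t) powr p) \<partial>poisson_pmf (real (card I) * r + r))"
    using nn_integral_poisson_add[OF I r, of "\<lambda>k. ennreal ((x + real k * t) powr p)"]
    by (simp add: algebra_simps)
  also have "real (card I) * r + r = real (card (insert i I)) * r"
    using insert by (simp add: algebra_simps)
  finally show ?case .
qed

text \<open>Taking \<open>r = 1 / card I\<close> makes the comparison variable \<open>t\<close> times a Poisson variable of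
  rate 1; enlarging both moments to \<open>r * t\<close> and \<open>r * t powr p\<close> is harmless because the majorant
  in \<open>powr_majorant\<close> has non-negative coefficients.\<close>
lemma (in prob_space) iid_sum_powr_le_Bell:
  fixes p t :: real and g :: "'a \<Rightarrow> real" and I :: "'i set"
  assumes "2 \<le> p" "0 < t"
    and "g \<in> borel_measurable M" "\<And>y. y \<in> space M \<Longrightarrow> 0 \<le> g y"
    and "(\<integral>\<^sup>+y. ennreal (g y) \<partial>M) \<le> ennreal (t / real (card I))"
    and "(\<integral>\<^sup>+y. ennreal (g y powr p) \<partial>M) \<le> ennreal (t powr p / real (card I))"
    and I: "finite I" "I \<noteq> {}"
  shows "(\<integral>\<^sup>+w. ennreal ((\<Sum>i\<in>I. g (w i)) powr p) \<partial>PiM I (\<lambda>_. M)) \<le> ennreal (Bell p * t powr p)"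
proof -
  have c: "0 < card I" using I by (simp add: card_gt_0_iff)
  have "(\<integral>\<^sup>+w. ennreal ((0 + (\<Sum>i\<in>I. g (w i))) powr p) \<partial>PiM I (\<lambda>_. M))
      \<le> (\<integral>\<^sup>+k. ennreal ((0 + real k * t) powr p) \<partial>poisson_pmf (real (card I) * (1 / real (card I))))"
    using assms c by (intro iid_sum_powr_le_poisson) auto
  also have "\<dots> = (\<integral>\<^sup>+k. ennreal (real k powr p) * ennreal (t powr p) \<partial>poisson_pmf 1)"
    using c assms by (simp add: powr_mult ennreal_mult)
  also have "\<dots> = ennreal (Bell p * t powr p)"
    by (simp add: nn_integral_multc Bell_eq_poisson_moment ennreal_mult Bell_nonneg)
  finally show ?thesis by simp
qed

subsection \<open>Minkowski's inequality\<close>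

text \<open>Isolates the infinite value once, so that elsewhere the norm is a real \<open>a\<close>
  whose \<open>p\<close>-th power is the moment.\<close>

lemma Lp_norm_cases [consumes 1, case_names infinite finite]:
  fixes p :: real
  assumes "0 < p"
  obtains (infinite) "Lp_norm M p h = \<infinity>" "(\<integral>\<^sup>+x. ennreal (\<bar>h x\<bar> powr p) \<partial>M) = \<infinity>"
  | (finite) a where "0 \<le> a" "Lp_norm M p h = ennreal a"
      "(\<integral>\<^sup>+x. ennreal (\<bar>h x\<bar> powr p) \<partial>M) = ennreal (a powr p)"
proof (cases "(\<integral>\<^sup>+x. ennreal (\<bar>h x\<bar> powr p) \<partial>M) = \<infinity>")
  case True
  then show thesis by (intro infinite) (auto simp: Lp_norm_def)
next
  case False
  define I where "I = enn2real (\<integral>\<^sup>+x. ennreal (\<bar>h x\<bar> powr p) \<partial>M)"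
  have I: "0 \<le> I" "(\<integral>\<^sup>+x. ennreal (\<bar>h x\<bar> powr p) \<partial>M) = ennreal I"
    using False by (auto simp: I_def less_top)
  show thesis
    by (rule finite[of "I powr (1 / p)"]) (use I assms False in \<open>auto simp: Lp_norm_def Let_def powr_powr\<close>)
qed

lemma Lp_norm_le_iff:
  fixes p a :: real
  assumes "0 < p" "0 \<le> a"
  shows "Lp_norm M p h \<le> ennreal a \<longleftrightarrow> (\<integral>\<^sup>+x. ennreal (\<bar>h x\<bar> powr p) \<partial>M) \<le> ennreal (a powr p)"
  using assms(1)
proof (cases rule: Lp_norm_cases[where M = M and h = h])
  case infinite
  then show ?thesis by (simp add: top_unique)
next
  case (finite b)
  then show ?thesis
    using assms powr_mono2[of p b a] powr_less_mono2[of p a b]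
    by (auto simp: ennreal_le_iff not_le[symmetric])
qed

lemma Lp_norm_cong_AE:
  assumes "AE x in M. f x = g x"
  shows "Lp_norm M p f = Lp_norm M p g"
proof -
  have "(\<integral>\<^sup>+x. ennreal (\<bar>f x\<bar> powr p) \<partial>M) = (\<integral>\<^sup>+x. ennreal (\<bar>g x\<bar> powr p) \<partial>M)"
    using assms by (intro nn_integral_cong_AE) auto
  then show ?thesis by (simp add: Lp_norm_def)
qed

lemma Lp_norm_cong:
  assumes "\<And>x. x \<in> space M \<Longrightarrow> f x = g x"
  shows "Lp_norm M p f = Lp_norm M p g"
  using assms by (intro Lp_norm_cong_AE) auto

lemma Lp_norm_distr:
  assumes "T \<in> measurable M N" "h \<in> borel_measurable N"
  shows "Lp_norm (distr M N T) p h = Lp_norm M p (\<lambda>x. h (T x))"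
  using assms by (simp add: Lp_norm_def nn_integral_distr)

lemma Lp_norm_cmult:
  fixes p c :: real
  assumes "0 < p" "h \<in> borel_measurable M"
  shows "Lp_norm M p (\<lambda>x. c * h x) = ennreal \<bar>c\<bar> * Lp_norm M p h"
proof -
  have *: "(\<integral>\<^sup>+x. ennreal (\<bar>c * h x\<bar> powr p) \<partial>M)
      = ennreal (\<bar>c\<bar> powr p) * (\<integral>\<^sup>+x. ennreal (\<bar>h x\<bar> powr p) \<partial>M)"
    using assms by (simp add: abs_mult powr_mult ennreal_mult nn_integral_cmult)
  show ?thesis
    using assms(1)
  proof (cases rule: Lp_norm_cases[where M = M and h = h])
    \<comment> \<open>For \<open>c = 0\<close> both sides are 0 because
      \<open>0 * \<infinity> = 0\<close> in \<open>ennreal\<close>.\<close>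
    case infinite
    then show ?thesis
      using * by (cases "c = 0") (auto simp: Lp_norm_def Let_def ennreal_mult_eq_top_iff ennreal_mult_top)
  next
    case (finite a)
    then show ?thesis
      using * assms
      by (auto simp: Lp_norm_def[of _ _ "\<lambda>x. c * h x"] powr_powr simp flip: powr_mult ennreal_mult)
  qed
qed

lemma Lp_norm_eq_0_AE:
  fixes p :: real
  assumes "0 < p" "h \<in> borel_measurable M" "Lp_norm M p h = 0"
  shows "AE x in M. h x = 0"
proof -
  have "(\<integral>\<^sup>+x. ennreal (\<bar>h x\<bar> powr p) \<partial>M) = 0"
    using assms(3) Lp_norm_le_iff[OF assms(1), of 0 M h] by simp
  then have "AE x in M. ennreal (\<bar>h x\<bar> powr p) = 0"
    using assms by (subst (asm) nn_integral_0_iff_AE) auto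
  then show ?thesis by eventually_elim auto
qed

section \<open>The triangle inequality by convexity\<close>

text \<open>Convexity at \<open>(u + v) / (a + b)\<close>, the mean of \<open>u / a\<close> and
  \<open>v / b\<close> with weights \<open>a / (a + b)\<close> and \<open>b / (a + b)\<close>. With
  the two norms as \<open>a\<close> and \<open>b\<close>, integration yields Minkowski's
  inequality.\<close>

lemma powr_add_weighted_le:
  fixes p a b u v :: real
  assumes "1 \<le> p" "0 < a" "0 < b" "0 \<le> u" "0 \<le> v"
  shows "(u + v) powr p
    \<le> (a + b) powr (p - 1) * (a powr (1 - p) * u powr p + b powr (1 - p) * v powr p)"
proof -
  let ?l = "b / (a + b)"
  have l: "1 - ?l = a / (a + b)" using assms by (simp add: field_simps)
  have "((1 - ?l) *\<^sub>R (u / a) + ?l *\<^sub>R (v / b)) powr p \<le> (1 - ?l) * (u / a) powr p + ?l * (v / b) powr p"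
    using assms by (intro convex_onD[OF convex_on_powr]) auto
  moreover have "(1 - ?l) *\<^sub>R (u / a) + ?l *\<^sub>R (v / b) = (u + v) / (a + b)"
    unfolding l using assms by (simp add: add_divide_distrib)
  ultimately have "((u + v) / (a + b)) powr p \<le> a / (a + b) * (u / a) powr p + b / (a + b) * (v / b) powr p"
    unfolding l by simp
  then have "(a + b) powr p * ((u + v) / (a + b)) powr p
      \<le> (a + b) powr p * (a / (a + b) * (u / a) powr p + b / (a + b) * (v / b) powr p)"
    by (intro mult_left_mono) auto
  also have "(a + b) powr p * ((u + v) / (a + b)) powr p = (u + v) powr p"
    using assms by (simp flip: powr_mult)
  also have "(a + b) powr p * (a / (a + b) * (u / a) powr p + b / (a + b) * (v / b) powr p)
      = (a + b) powr (p - 1) * (a powr (1 - p) * u powr p + b powr (1 - p) * v powr p)"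
  proof -
    have 1: "a * (u / a) powr p = a powr (1 - p) * u powr p" "b * (v / b) powr p = b powr (1 - p) * v powr p"
      using assms by (simp_all add: powr_divide powr_diff)
    have "(a + b) powr p * (a / (a + b) * (u / a) powr p + b / (a + b) * (v / b) powr p)
        = (a + b) powr p / (a + b) * (a * (u / a) powr p + b * (v / b) powr p)"
      by (simp add: algebra_simps add_divide_distrib)
    then show ?thesis
      using assms unfolding 1 by (simp add: powr_diff)
  qed
  finally show ?thesis .
qed

lemma Lp_norm_add_le:
  fixes p :: real
  assumes p: "1 \<le> p" and [measurable]: "f \<in> borel_measurable M" "g \<in> borel_measurable M"
  shows "Lp_norm M p (\<lambda>x. f x + g x) \<le> Lp_norm M p f + Lp_norm M p g"
proof -
  have p0: "0 < p" using p by simp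
  show ?thesis
    using p0
  proof (cases rule: Lp_norm_cases[where M = M and h = f])
    case (finite a)
    note f = this
    show ?thesis
      using p0
  proof (cases rule: Lp_norm_cases[where M = M and h = g])
      case (finite b)
      note g = this
      \<comment> \<open>The weighted inequality divides by both norms; a function of norm 0 vanishes
        almost everywhere and drops out.\<close>
      consider "a = 0" | "b = 0" | "0 < a" "0 < b" using f g by linarith
      then show ?thesis
      proof cases
        case 1
        then have "AE x in M. f x = 0" using f p0 by (intro Lp_norm_eq_0_AE) auto
        then have "Lp_norm M p (\<lambda>x. f x + g x) = Lp_norm M p g" by (intro Lp_norm_cong_AE) auto
        then show ?thesis by simp
      next
        case 2
        then have "AE x in M. g x = 0" using g p0 by (intro Lp_norm_eq_0_AE) auto
        then have "Lp_norm M p (\<lambda>x. f x + g x) = Lp_norm M p f" by (intro Lp_norm_cong_AE) auto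
        then show ?thesis by simp
      next
        case 3
        \<comment> \<open>After integration the weighted terms are exactly \<open>a\<close> and
          \<open>b\<close>, and the prefactor completes their sum to
          \<open>(a + b) powr p\<close>.\<close>
        have pow: "a powr (1 - p) * a powr p = a" "b powr (1 - p) * b powr p = b"
          "(a + b) powr (p - 1) * (a + b) = (a + b) powr p"
          using 3 powr_mult_base[of "a + b" "p - 1"] by (simp_all add: mult.commute flip: powr_add)
        have "(\<integral>\<^sup>+x. ennreal (\<bar>f x + g x\<bar> powr p) \<partial>M)
          \<le> (\<integral>\<^sup>+x. ennreal ((a + b) powr (p - 1)) * (ennreal (a powr (1 - p)) * ennreal (\<bar>f x\<bar> powr p)
              + ennreal (b powr (1 - p)) * ennreal (\<bar>g x\<bar> powr p)) \<partial>M)"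
        proof (intro nn_integral_mono)
          fix x
          have "\<bar>f x + g x\<bar> powr p \<le> (\<bar>f x\<bar> + \<bar>g x\<bar>) powr p"
            using p by (intro powr_mono2) auto
          also have "\<dots> \<le> (a + b) powr (p - 1) * (a powr (1 - p) * \<bar>f x\<bar> powr p + b powr (1 - p) * \<bar>g x\<bar> powr p)"
            using p 3 by (intro powr_add_weighted_le) auto
          finally show "ennreal (\<bar>f x + g x\<bar> powr p)
            \<le> ennreal ((a + b) powr (p - 1)) * (ennreal (a powr (1 - p)) * ennreal (\<bar>f x\<bar> powr p)
              + ennreal (b powr (1 - p)) * ennreal (\<bar>g x\<bar> powr p))"
            by (simp flip: ennreal_mult ennreal_plus)
        qed
        also have "\<dots> = ennreal ((a + b) powr (p - 1)) * (ennreal (a powr (1 - p)) * ennreal (a powr p)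
              + ennreal (b powr (1 - p)) * ennreal (b powr p))"
          using f g by (simp add: nn_integral_cmult nn_integral_add)
        also have "\<dots> = ennreal ((a + b) powr p)"
          using 3 pow by (simp flip: ennreal_mult ennreal_plus)
        finally have "Lp_norm M p (\<lambda>x. f x + g x) \<le> ennreal (a + b)"
          using 3 p0 by (simp add: Lp_norm_le_iff del: ennreal_plus)
        then show ?thesis using f g by simp
      qed
    qed simp
  qed simp
qed

lemma Lp_norm_zero: "0 < p \<Longrightarrow> Lp_norm M p (\<lambda>x. 0) = 0"
  by (simp add: Lp_norm_def)

lemma Lp_norm_sum_le:
  fixes p :: real
  assumes p: "1 \<le> p" and I: "finite I" and "\<And>i. i \<in> I \<Longrightarrow> f i \<in> borel_measurable M"
  shows "Lp_norm M p (\<lambda>x. \<Sum>i\<in>I. f i x) \<le> (\<Sum>i\<in>I. Lp_norm M p (f i))"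
  using I assms(3)
proof (induction I)
  case empty
  then show ?case using p by (simp add: Lp_norm_zero)
next
  case (insert i I)
  have "Lp_norm M p (\<lambda>x. f i x + (\<Sum>i\<in>I. f i x)) \<le> Lp_norm M p (f i) + Lp_norm M p (\<lambda>x. \<Sum>i\<in>I. f i x)"
    using insert p by (intro Lp_norm_add_le) auto
  also have "\<dots> \<le> Lp_norm M p (f i) + (\<Sum>i\<in>I. Lp_norm M p (f i))"
    using insert by (intro add_left_mono) auto
  finally show ?case using insert by simp
qed

text \<open>The power \<open>p\<close> passes through the finite product and keeps independence, so
  the \<open>p\<close>-th moment factorises. The \<open>a i\<close> will be values of
  \<open>Theta\<close>.\<close>

lemma (in prob_space) Lp_norm_prod_indep_le:
  fixes p :: real and U :: "'i \<Rightarrow> 'a \<Rightarrow> real"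
  assumes p: "0 < p" and I: "finite I" and ind: "indep_vars (\<lambda>_. borel) U I"
    and a: "\<And>i. i \<in> I \<Longrightarrow> 0 \<le> a i" "\<And>i. i \<in> I \<Longrightarrow> Lp_norm M p (U i) \<le> ennreal (a i)"
  shows "Lp_norm M p (\<lambda>x. \<Prod>i\<in>I. U i x) \<le> ennreal (\<Prod>i\<in>I. a i)"
proof -
  have pp: "\<bar>\<Prod>i\<in>I. U i x\<bar> powr p = (\<Prod>i\<in>I. \<bar>U i x\<bar> powr p)" for x
    by (simp add: abs_prod prod_powr_distrib)
  have "(\<integral>\<^sup>+x. ennreal (\<bar>\<Prod>i\<in>I. U i x\<bar> powr p) \<partial>M) = (\<integral>\<^sup>+x. (\<Prod>i\<in>I. ennreal (\<bar>U i x\<bar> powr p)) \<partial>M)"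
    unfolding pp by (simp add: prod_ennreal)
  also have "\<dots> = (\<Prod>i\<in>I. \<integral>\<^sup>+x. ennreal (\<bar>U i x\<bar> powr p) \<partial>M)"
    using I by (intro indep_vars_nn_integral indep_vars_compose2[OF ind]) auto
  also have "\<dots> \<le> (\<Prod>i\<in>I. ennreal (a i powr p))"
    using a p by (intro prod_mono_ennreal) (auto simp: Lp_norm_le_iff)
  also have "\<dots> = ennreal ((\<Prod>i\<in>I. a i) powr p)"
    using a by (simp add: prod_ennreal prod_powr_distrib)
  finally show ?thesis
    using a p by (simp add: Lp_norm_le_iff prod_nonneg)
qed

subsection \<open>Averages of i.i.d. variables\<close>

lemma Lp_funs_iff:
  fixes p :: real
  assumes "0 < p"
  shows "h \<in> Lp_funs M p \<longleftrightarrow> h \<in> borel_measurable M \<and> integrable M (\<lambda>x. \<bar>h x\<bar> powr p)"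
  using assms
proof (cases rule: Lp_norm_cases[where M = M and h = h])
  case infinite
  then show ?thesis by (auto simp: Lp_funs_def integrable_iff_bounded)
next
  case (finite a)
  then show ?thesis by (auto simp: Lp_funs_def integrable_iff_bounded)
qed

text \<open>Domination by \<open>1 + \<bar>h x\<bar> powr p\<close>, whose constant is integrable on
  a probability space. It ensures that the first moment in \<open>V_bound\<close> is not the default
  value of a divergent Bochner integral.\<close>

lemma (in prob_space) integrable_of_powr:
  fixes p :: real
  assumes "1 \<le> p" and [measurable]: "h \<in> borel_measurable M" and "integrable M (\<lambda>x. \<bar>h x\<bar> powr p)"
  shows "integrable M h"
proof (rule Bochner_Integration.integrable_bound)
  show "integrable M (\<lambda>x. 1 + \<bar>h x\<bar> powr p)"
    using assms by (intro Bochner_Integration.integrable_add) auto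
  show "AE x in M. norm (h x) \<le> norm (1 + \<bar>h x\<bar> powr p)"
  proof (rule AE_I2)
    fix x
    show "norm (h x) \<le> norm (1 + \<bar>h x\<bar> powr p)"
    proof (cases "\<bar>h x\<bar> \<le> 1")
      case True
      moreover have "0 \<le> \<bar>h x\<bar> powr p" by simp
      ultimately show ?thesis by (simp del: powr_ge_zero)
    next
      case False
      then have "\<bar>h x\<bar> powr 1 \<le> \<bar>h x\<bar> powr p" using assms by (intro powr_mono) auto
      then show ?thesis using False by simp
    qed
  qed
qed fact

lemma A_bound_nonneg: "0 \<le> A_bound P p n \<zeta>"
  unfolding A_bound_def by (intro divide_nonneg_nonneg sum_nonneg) auto

lemma V_bound_nonneg: "0 \<le> V_bound P p n \<zeta>"
  unfolding V_bound_def by (intro mult_nonneg_nonneg divide_nonneg_nonneg) (auto simp: le_max_iff_disj)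

lemma Theta_nonneg: "0 \<le> Theta P p n \<zeta>"
  unfolding Theta_def by (simp add: A_bound_nonneg V_bound_nonneg)

text \<open>Minkowski's inequality, once each norm is identified with the root of a Bochner moment;
  membership in \<open>Lp_funs\<close> makes that moment a true integral.\<close>

lemma (in prob_space) Lp_norm_avg_le_A_bound:
  fixes p :: real
  assumes p: "1 \<le> p" and n: "1 \<le> n"
    and \<zeta>: "\<And>j. j \<in> {1..n} \<Longrightarrow> \<zeta> j \<in> Lp_funs M p"
      "\<And>j x. j \<in> {1..n} \<Longrightarrow> x \<in> space M \<Longrightarrow> 0 \<le> \<zeta> j x"
  shows "Lp_norm M p (\<lambda>x. (\<Sum>j = 1..n. \<zeta> j x) / real n) \<le> ennreal (A_bound M p n \<zeta>)"
proof -
  have norm: "Lp_norm M p (\<zeta> j) \<le> ennreal (moment M \<zeta> j p powr (1 / p))" if j: "j \<in> {1..n}" for j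
  proof -
    have eq: "(\<integral>\<^sup>+x. ennreal (\<bar>\<zeta> j x\<bar> powr p) \<partial>M) = (\<integral>\<^sup>+x. ennreal (\<zeta> j x powr p) \<partial>M)"
      using \<zeta>(2)[OF j] by (intro nn_integral_cong) simp
    have int: "integrable M (\<lambda>x. \<zeta> j x powr p)"
      using \<zeta>(1)[OF j] \<zeta>(2)[OF j] p by (auto simp: Lp_funs_iff cong: Bochner_Integration.integrable_cong)
    have "(\<integral>\<^sup>+x. ennreal (\<bar>\<zeta> j x\<bar> powr p) \<partial>M) = ennreal (moment M \<zeta> j p)"
      unfolding eq moment_def by (intro nn_integral_eq_integral int) auto
    moreover have "0 \<le> moment M \<zeta> j p" unfolding moment_def by simp
    ultimately show ?thesis using p by (simp add: Lp_norm_le_iff powr_powr)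
  qed
  have meas: "\<zeta> j \<in> borel_measurable M" if "j \<in> {1..n}" for j
    using \<zeta>(1)[OF that] by (simp add: Lp_funs_def)
  have "Lp_norm M p (\<lambda>x. (1 / real n) * (\<Sum>j = 1..n. \<zeta> j x))
      = ennreal (1 / real n) * Lp_norm M p (\<lambda>x. \<Sum>j = 1..n. \<zeta> j x)"
    using p meas by (subst Lp_norm_cmult) auto
  also have "\<dots> \<le> ennreal (1 / real n) * (\<Sum>j = 1..n. Lp_norm M p (\<zeta> j))"
    using p meas by (intro mult_left_mono Lp_norm_sum_le) auto
  also have "\<dots> \<le> ennreal (1 / real n) * (\<Sum>j = 1..n. ennreal (moment M \<zeta> j p powr (1 / p)))"
    by (intro mult_left_mono sum_mono norm) auto
  also have "\<dots> = ennreal (A_bound M p n \<zeta>)"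
    by (simp add: A_bound_def sum_nonneg flip: ennreal_mult)
  finally show ?thesis by simp
qed

text \<open>Serves twice: to move a sum of i.i.d. variables to a product space, and to identify the
  law of a random point of the full product.\<close>

lemma (in prob_space) distr_restrict_indep:
  assumes "indep_vars N Y I" "I \<noteq> {}" "\<And>i. i \<in> I \<Longrightarrow> distr M (N i) (Y i) = N i"
  shows "distr M (PiM I N) (\<lambda>x. \<lambda>i\<in>I. Y i x) = PiM I N"
proof -
  have "distr M (PiM I N) (\<lambda>x. \<lambda>i\<in>I. Y i x) = PiM I (\<lambda>i. distr M (N i) (Y i))"
    using assms(1) by (subst indep_vars_iff_distr_eq_PiM'[symmetric, OF assms(2)]) (auto simp: indep_vars_def)
  also have "\<dots> = PiM I N"
    using assms(3) by (intro PiM_cong) auto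
  finally show ?thesis .
qed

lemma (in prob_space) Lp_norm_iid_avg_le_Theta:
  fixes p :: real and g :: "'b \<Rightarrow> real"
  assumes p: "2 \<le> p" and n: "1 \<le> n" and N: "prob_space N"
    and ind: "indep_vars (\<lambda>_. N) Y {1..n}"
    and law: "\<And>j. j \<in> {1..n} \<Longrightarrow> distr M N (Y j) = N"
    and g: "g \<in> Lp_funs N p" and g0: "\<And>y. y \<in> space N \<Longrightarrow> 0 \<le> g y"
  shows "Lp_norm M p (\<lambda>x. (\<Sum>j = 1..n. g (Y j x)) / real n)
    \<le> ennreal (Theta M p n (\<lambda>j x. g (Y j x)))"
proof -
  interpret N: prob_space N by fact
  have Y [measurable]: "Y j \<in> measurable M N" if "j \<in> {1..n}" for j
    using ind that by (auto simp: indep_vars_def)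
  have gm [measurable]: "g \<in> borel_measurable N" using g by (simp add: Lp_funs_def)
  define m1 where "m1 = (\<integral>y. g y \<partial>N)"
  define mp where "mp = (\<integral>y. g y powr p \<partial>N)"
  have int: "integrable N (\<lambda>y. \<bar>g y\<bar> powr p)"
    using g p by (simp add: Lp_funs_iff)
  have int_p: "integrable N (\<lambda>y. g y powr p)"
    using int g0 by (simp cong: Bochner_Integration.integrable_cong)
  have int_1: "integrable N g"
    using N.integrable_of_powr[of p g] int p by simp
  have m1: "(\<integral>\<^sup>+y. ennreal (g y) \<partial>N) = ennreal m1"
    unfolding m1_def using g0 by (intro nn_integral_eq_integral int_1) auto
  have mp: "(\<integral>\<^sup>+y. ennreal (g y powr p) \<partial>N) = ennreal mp"
    unfolding mp_def by (intro nn_integral_eq_integral int_p) auto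
  have nonneg: "0 \<le> m1" "0 \<le> mp"
    unfolding m1_def mp_def using g0 by (auto intro!: integral_nonneg_AE)
  have mom_p: "moment M (\<lambda>j x. g (Y j x)) j p = mp" if j: "j \<in> {1..n}" for j
  proof -
    have "mp = (\<integral>y. g y powr p \<partial>distr M N (Y j))" unfolding law[OF j] mp_def ..
    also have "\<dots> = moment M (\<lambda>j x. g (Y j x)) j p"
      unfolding moment_def using j by (subst integral_distr) auto
    finally show ?thesis ..
  qed
  have mom_1: "moment M (\<lambda>j x. g (Y j x)) j 1 = m1" if j: "j \<in> {1..n}" for j
  proof -
    have "m1 = (\<integral>y. g y powr 1 \<partial>N)" unfolding m1_def
      using g0 by (intro Bochner_Integration.integral_cong) auto
    also have "\<dots> = (\<integral>y. g y powr 1 \<partial>distr M N (Y j))" unfolding law[OF j] ..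
    also have "\<dots> = moment M (\<lambda>j x. g (Y j x)) j 1"
      unfolding moment_def using j by (subst integral_distr) auto
    finally show ?thesis ..
  qed
  have A: "Lp_norm M p (\<lambda>x. (\<Sum>j = 1..n. g (Y j x)) / real n) \<le> ennreal (A_bound M p n (\<lambda>j x. g (Y j x)))"
  proof (intro Lp_norm_avg_le_A_bound)
    fix j assume j: "j \<in> {1..n}"
    have "Lp_norm M p (\<lambda>x. g (Y j x)) = Lp_norm N p g"
      using Lp_norm_distr[of "Y j" M N g p] law[OF j] Y[OF j] gm by simp
    then show "(\<lambda>x. g (Y j x)) \<in> Lp_funs M p"
      using g Y[OF j] by (simp add: Lp_funs_def)
    fix x assume "x \<in> space M"
    then show "0 \<le> g (Y j x)" using g0 measurable_space[OF Y[OF j]] by simp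
  qed (use p n in auto)
  \<comment> \<open>The least \<open>t\<close> with \<open>m1 \<le> t / n\<close> and
    \<open>mp \<le> t powr p / n\<close>, as the Poisson comparison requires; up to the factor
    \<open>Bell p powr (1 / p) / n\<close> it is \<open>V_bound\<close>.\<close>
  define t where "t = max ((real n * mp) powr (1 / p)) (real n * m1)"
  have V_eq: "V_bound M p n (\<lambda>j x. g (Y j x)) = Bell p powr (1 / p) / real n * t"
    using mom_p mom_1 by (simp add: V_bound_def t_def)
  have V: "Lp_norm M p (\<lambda>x. (\<Sum>j = 1..n. g (Y j x)) / real n) \<le> ennreal (V_bound M p n (\<lambda>j x. g (Y j x)))"
  proof (cases "0 < t")
    case True
    have "m1 \<le> t / real n" using n by (simp add: t_def field_simps)
    moreover have "mp \<le> t powr p / real n"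
    proof -
      have "real n * mp = ((real n * mp) powr (1 / p)) powr p"
        using nonneg p by (simp add: powr_powr)
      also have "\<dots> \<le> t powr p" using p by (intro powr_mono2) (auto simp: t_def)
      finally show ?thesis using n by (simp add: field_simps)
    qed
    ultimately have B: "(\<integral>\<^sup>+w. ennreal ((\<Sum>i\<in>{1..n}. g (w i)) powr p) \<partial>PiM {1..n} (\<lambda>_. N))
        \<le> ennreal (Bell p * t powr p)"
      using p n True g0 m1 mp
      by (intro N.iid_sum_powr_le_Bell) (auto intro: ennreal_leI)
    \<comment> \<open>The joint law of the \<open>Y j\<close> is the product measure, so the bound
      \<open>B\<close> carries over to \<open>M\<close>.\<close>
    have D: "distr M (PiM {1..n} (\<lambda>_. N)) (\<lambda>x. \<lambda>i\<in>{1..n}. Y i x) = PiM {1..n} (\<lambda>_. N)"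
      using n law by (intro distr_restrict_indep ind) auto
    have "Lp_norm M p (\<lambda>x. \<Sum>j = 1..n. g (Y j x)) = Lp_norm (PiM {1..n} (\<lambda>_. N)) p (\<lambda>w. \<Sum>j = 1..n. g (w j))"
    proof (subst D[symmetric], subst Lp_norm_distr)
      show "(\<lambda>x. \<lambda>i\<in>{1..n}. Y i x) \<in> measurable M (PiM {1..n} (\<lambda>_. N))"
        using Y by (intro measurable_restrict) auto
    qed (auto intro!: Lp_norm_cong)
    also have "\<dots> \<le> ennreal (Bell p powr (1 / p) * t)"
    proof (subst Lp_norm_le_iff)
      have "(\<integral>\<^sup>+w. ennreal (\<bar>\<Sum>i = 1..n. g (w i)\<bar> powr p) \<partial>PiM {1..n} (\<lambda>_. N))
          = (\<integral>\<^sup>+w. ennreal ((\<Sum>i\<in>{1..n}. g (w i)) powr p) \<partial>PiM {1..n} (\<lambda>_. N))"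
        using g0 by (intro nn_integral_cong) (auto simp: space_PiM PiE_iff intro!: abs_of_nonneg sum_nonneg arg_cong2[where f = "(powr)"])
      also note B
      also have "Bell p * t powr p = (Bell p powr (1 / p) * t) powr p"
        using p True Bell_nonneg[of p] by (simp add: powr_mult powr_powr)
      finally show "(\<integral>\<^sup>+w. ennreal (\<bar>\<Sum>i = 1..n. g (w i)\<bar> powr p) \<partial>PiM {1..n} (\<lambda>_. N))
          \<le> ennreal ((Bell p powr (1 / p) * t) powr p)" .
    qed (use p True in auto)
    finally have S: "Lp_norm M p (\<lambda>x. \<Sum>j = 1..n. g (Y j x)) \<le> ennreal (Bell p powr (1 / p) * t)" .
    have "Lp_norm M p (\<lambda>x. (1 / real n) * (\<Sum>j = 1..n. g (Y j x)))
        = ennreal (1 / real n) * Lp_norm M p (\<lambda>x. \<Sum>j = 1..n. g (Y j x))"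
      using p by (subst Lp_norm_cmult) auto
    also have "\<dots> \<le> ennreal (1 / real n) * ennreal (Bell p powr (1 / p) * t)"
      by (intro mult_left_mono S) auto
    also have "\<dots> = ennreal (V_bound M p n (\<lambda>j x. g (Y j x)))"
      using True by (simp add: V_eq flip: ennreal_mult)
    finally show ?thesis by simp
  next
    \<comment> \<open>The comparison needs \<open>t > 0\<close>. Otherwise \<open>mp = 0\<close>,
      and the bound by \<open>A_bound\<close>, now 0, already gives the claim.\<close>
    case False
    then have "(real n * mp) powr (1 / p) \<le> 0" by (simp add: t_def not_less)
    then have "(real n * mp) powr (1 / p) = 0" by (intro order.antisym) auto
    then have "mp = 0" using n by simp
    then have "A_bound M p n (\<lambda>j x. g (Y j x)) = 0"
      using mom_p by (simp add: A_bound_def)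
    with A show ?thesis by simp
  qed
  from A V show ?thesis by (simp add: Theta_def min_def)
qed

subsection \<open>Multi-index averages\<close>

text \<open>Injectivity makes the singleton blocks \<open>{h j}\<close> disjoint, and projecting
  each block recovers its variable. It extracts a row \<open>j \<mapsto> (j, s)\<close> or a
  transversal \<open>s \<mapsto> (k s, s)\<close> from the doubly indexed family.\<close>

lemma (in prob_space) indep_vars_reindex:
  assumes ind: "indep_vars N Y I" and h: "inj_on h J" "h ` J \<subseteq> I"
  shows "indep_vars (\<lambda>j. N (h j)) (\<lambda>j. Y (h j)) J"
proof -
  have "indep_vars (\<lambda>j. PiM {h j} N) (\<lambda>j x. \<lambda>i\<in>{h j}. Y i x) J"
    using h by (intro indep_vars_restrict[OF ind]) (auto simp: disjoint_family_on_def inj_on_def)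
  then have "indep_vars (\<lambda>j. N (h j)) (\<lambda>j x. (\<lambda>i\<in>{h j}. Y i x) (h j)) J"
    by (rule indep_vars_compose2[where Y = "\<lambda>j w. w (h j)"]) (auto intro: measurable_component_singleton)
  then show ?thesis by simp
qed

lemma finite_index_box [simp]: "finite (index_box d n)"
  by (simp add: index_box_def finite_PiE)

lemma card_index_box: "card (index_box d n) = (\<Prod>s = 1..d. n s)"
  by (simp add: index_box_def card_PiE)

lemma multi_index_le:
  assumes "k \<in> multi_indices d" "N_max d k \<le> M" "s \<in> {1..d}"
  shows "k s \<in> {1..M}"
proof -
  have "k s \<le> N_max d k" unfolding N_max_def using assms(3) by (intro Max_ge) auto
  moreover have "1 \<le> k s" using assms by (auto simp: multi_indices_def PiE_iff)
  ultimately show ?thesis using assms(2) by simp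
qed

text \<open>Keeps the sums in \<open>rep_fun\<close> and \<open>triple_Theta\<close> from being the
  default 0 of an infinite index set.\<close>

lemma finite_multi_indices_le: "finite {k. k \<in> multi_indices d \<and> N_max d k \<le> M}"
proof (rule finite_subset)
  show "{k. k \<in> multi_indices d \<and> N_max d k \<le> M} \<subseteq> ({1..d} \<rightarrow>\<^sub>E {1..M})"
  proof
    fix k assume k: "k \<in> {k. k \<in> multi_indices d \<and> N_max d k \<le> M}"
    then have "k s = undefined" if "s \<notin> {1..d}" for s
      using that by (simp add: multi_indices_def PiE_iff extensional_def)
    then show "k \<in> ({1..d} \<rightarrow>\<^sub>E {1..M})"
      using k multi_index_le[of k d M] by (intro PiE_I) auto
  qed
qed (simp add: finite_PiE)

text \<open>A box is a Cartesian product: the sum of a product over it is the product of the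
  coordinate sums, and its cardinality factorises likewise.\<close>

lemma S_avg_rep_fun:
  "S_avg d \<xi> (index_box d n) (rep_fun d M lam g) \<omega>
    = (\<Sum>k | k \<in> multi_indices d \<and> N_max d k \<le> M.
        lam k * (\<Prod>s = 1..d. (\<Sum>j = 1..n s. g s (k s) (\<xi> j s \<omega>)) / real (n s)))"
proof -
  have prod: "(\<Prod>s = 1..d. (\<Sum>j = 1..n s. g s (k s) (\<xi> j s \<omega>)) / real (n s))
      = (\<Sum>l\<in>index_box d n. \<Prod>s = 1..d. g s (k s) (\<xi> (l s) s \<omega>)) / real (card (index_box d n))" for k
    unfolding card_index_box by (simp add: prod_dividef prod_sum_PiE index_box_def)
  show ?thesis
    unfolding S_avg_def rep_fun_def prod
    by (subst sum.swap) (simp add: sum_distrib_left sum_divide_distrib)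
qed

text \<open>Every random point has the product law, so all summands have the norm of
  \<open>h\<close>. The triangle inequality copes with the dependence between points sharing
  coordinates.\<close>

lemma Lp_norm_S_avg_le:
  fixes p :: real
  assumes p: "1 \<le> p" and L: "finite L" "L \<noteq> {}" and h: "h \<in> borel_measurable (PiM {1..d} X)"
    and T: "\<And>k. k \<in> L \<Longrightarrow> (\<lambda>\<omega>. \<lambda>s\<in>{1..d}. \<xi> (k s) s \<omega>) \<in> measurable P (PiM {1..d} X)"
    and law: "\<And>k. k \<in> L \<Longrightarrow> distr P (PiM {1..d} X) (\<lambda>\<omega>. \<lambda>s\<in>{1..d}. \<xi> (k s) s \<omega>) = PiM {1..d} X"
  shows "Lp_norm P p (S_avg d \<xi> L h) \<le> Lp_norm (PiM {1..d} X) p h"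
proof -
  let ?T = "\<lambda>k \<omega>. \<lambda>s\<in>{1..d}. \<xi> (k s) s \<omega>"
  have c: "0 < card L" using L by (simp add: card_gt_0_iff)
  have meas: "(\<lambda>\<omega>. h (?T k \<omega>)) \<in> borel_measurable P" if "k \<in> L" for k
    using h T[OF that] by simp
  have "Lp_norm P p (S_avg d \<xi> L h) = Lp_norm P p (\<lambda>\<omega>. (1 / real (card L)) * (\<Sum>k\<in>L. h (?T k \<omega>)))"
    by (intro Lp_norm_cong) (simp add: S_avg_def)
  also have "\<dots> = ennreal (1 / real (card L)) * Lp_norm P p (\<lambda>\<omega>. \<Sum>k\<in>L. h (?T k \<omega>))"
    using p meas by (subst Lp_norm_cmult) auto
  also have "\<dots> \<le> ennreal (1 / real (card L)) * (\<Sum>k\<in>L. Lp_norm P p (\<lambda>\<omega>. h (?T k \<omega>)))"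
    using p L meas by (intro mult_left_mono Lp_norm_sum_le) auto
  also have "(\<Sum>k\<in>L. Lp_norm P p (\<lambda>\<omega>. h (?T k \<omega>))) = (\<Sum>k\<in>L. Lp_norm (PiM {1..d} X) p h)"
  proof (rule sum.cong)
    fix k assume k: "k \<in> L"
    show "Lp_norm P p (\<lambda>\<omega>. h (?T k \<omega>)) = Lp_norm (PiM {1..d} X) p h"
      using Lp_norm_distr[OF T[OF k] h, of p] law[OF k] by simp
  qed simp
  also have "ennreal (1 / real (card L)) * \<dots> = Lp_norm (PiM {1..d} X) p h"
    using c by (simp add: ennreal_of_nat_eq_real_of_nat mult.assoc[symmetric] flip: ennreal_mult)
  finally show ?thesis .
qed

text \<open>For fixed \<open>k\<close> the row averages \<open>?U k s\<close> are independent over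
  \<open>s\<close>, so their norms multiply, each at most a \<open>Theta\<close>. Different
  \<open>k\<close> are combined by the triangle inequality, hence
  \<open>\<bar>lam k\<bar>\<close>.\<close>

lemma (in prob_space) Lp_norm_S_avg_rep_fun_le:
  fixes p :: real
  assumes p: "2 \<le> p" and X: "\<And>s. s \<in> {1..d} \<Longrightarrow> prob_space (X s)"
    and ind: "indep_vars (\<lambda>(i, s). X s) (\<lambda>(i, s). \<xi> i s) ({1..} \<times> {1..d})"
    and law: "\<And>i s. i \<ge> 1 \<Longrightarrow> s \<in> {1..d} \<Longrightarrow> distr M (X s) (\<xi> i s) = X s"
    and rep: "D_plus_rep X d p m lam g" and n: "\<forall>s\<in>{1..d}. 1 \<le> n s"
  shows "Lp_norm M p (S_avg d \<xi> (index_box d n) (rep_fun d m lam g))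
    \<le> ennreal (triple_Theta M \<xi> d p n m lam g)"
proof -
  let ?K = "{k. k \<in> multi_indices d \<and> N_max d k \<le> m}"
  let ?U = "\<lambda>k s \<omega>. (\<Sum>j = 1..n s. g s (k s) (\<xi> j s \<omega>)) / real (n s)"
  let ?Th = "\<lambda>k s. Theta M p (n s) (\<lambda>j \<omega>. g s (k s) (\<xi> j s \<omega>))"
  have g: "g s (k s) \<in> Lp_funs (X s) p" "\<And>y. y \<in> space (X s) \<Longrightarrow> 0 \<le> g s (k s) y"
    if "k \<in> ?K" "s \<in> {1..d}" for k s
    using rep multi_index_le[of k d m s] that unfolding D_plus_rep_def by auto
  have gm: "g s (k s) \<in> borel_measurable (X s)" if "k \<in> ?K" "s \<in> {1..d}" for k s
    using g(1)[OF that] by (simp add: Lp_funs_def)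
  have indU: "indep_vars (\<lambda>_. borel) (?U k) {1..d}" if k: "k \<in> ?K" for k
  proof -
    \<comment> \<open>Row \<open>s\<close> uses only the index pairs with second entry
      \<open>s\<close>; these blocks are disjoint, and \<open>?U k s\<close> is a measurable
      function of its block.\<close>
    let ?B = "\<lambda>s. {1..n s} \<times> {s}"
    have "indep_vars (\<lambda>s. PiM (?B s) (\<lambda>(i, s). X s)) (\<lambda>s \<omega>. \<lambda>q\<in>?B s. (case q of (i, s) \<Rightarrow> \<xi> i s) \<omega>) {1..d}"
      by (rule indep_vars_restrict[OF ind]) (auto simp: disjoint_family_on_def)
    then have "indep_vars (\<lambda>_. borel)
        (\<lambda>s \<omega>. (\<Sum>j = 1..n s. g s (k s) ((\<lambda>q\<in>?B s. (case q of (i, s) \<Rightarrow> \<xi> i s) \<omega>) (j, s))) / real (n s)) {1..d}"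
    proof (rule indep_vars_compose2[where Y = "\<lambda>s w. (\<Sum>j = 1..n s. g s (k s) (w (j, s))) / real (n s)"])
      fix s assume s: "s \<in> {1..d}"
      have "(\<lambda>w. w (j, s)) \<in> measurable (PiM (?B s) (\<lambda>(i, s). X s)) (X s)" if "j \<in> {1..n s}" for j
        using measurable_component_singleton[of "(j, s)" "?B s" "\<lambda>(i, s). X s"] that by simp
      then show "(\<lambda>w. (\<Sum>j = 1..n s. g s (k s) (w (j, s))) / real (n s))
          \<in> borel_measurable (PiM (?B s) (\<lambda>(i, s). X s))"
        using gm[OF k s] by (intro borel_measurable_divide borel_measurable_sum) (auto intro: measurable_compose)
    qed
    then show ?thesis by simp
  qed
  have normU: "Lp_norm M p (?U k s) \<le> ennreal (?Th k s)" if k: "k \<in> ?K" and s: "s \<in> {1..d}" for k s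
  proof (rule Lp_norm_iid_avg_le_Theta[OF p, where N = "X s" and Y = "\<lambda>j. \<xi> j s" and n = "n s" and g = "g s (k s)"])
    show "indep_vars (\<lambda>_. X s) (\<lambda>j. \<xi> j s) {1..n s}"
      using indep_vars_reindex[OF ind, of "\<lambda>j. (j, s)" "{1..n s}"] s
      by (auto simp: inj_on_def image_subset_iff)
  qed (use n s X law g[OF k s] in auto)
  have "Lp_norm M p (S_avg d \<xi> (index_box d n) (rep_fun d m lam g))
      = Lp_norm M p (\<lambda>\<omega>. \<Sum>k\<in>?K. lam k * (\<Prod>s = 1..d. ?U k s \<omega>))"
    by (intro Lp_norm_cong S_avg_rep_fun)
  also have "\<dots> \<le> (\<Sum>k\<in>?K. Lp_norm M p (\<lambda>\<omega>. lam k * (\<Prod>s = 1..d. ?U k s \<omega>)))"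
    using p indU by (intro Lp_norm_sum_le finite_multi_indices_le) (auto simp: indep_vars_def intro!: borel_measurable_times borel_measurable_prod)
  also have "\<dots> \<le> (\<Sum>k\<in>?K. ennreal (\<bar>lam k\<bar> * (\<Prod>s = 1..d. ?Th k s)))"
  proof (rule sum_mono)
    fix k assume k: "k \<in> ?K"
    have "Lp_norm M p (\<lambda>\<omega>. lam k * (\<Prod>s = 1..d. ?U k s \<omega>))
        = ennreal \<bar>lam k\<bar> * Lp_norm M p (\<lambda>\<omega>. \<Prod>s = 1..d. ?U k s \<omega>)"
      using p indU[OF k] by (intro Lp_norm_cmult) (auto simp: indep_vars_def intro!: borel_measurable_prod)
    also have "\<dots> \<le> ennreal \<bar>lam k\<bar> * ennreal (\<Prod>s = 1..d. ?Th k s)"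
      using p k by (intro mult_left_mono Lp_norm_prod_indep_le indU normU Theta_nonneg) auto
    also have "\<dots> = ennreal (\<bar>lam k\<bar> * (\<Prod>s = 1..d. ?Th k s))"
      by (simp add: Theta_nonneg prod_nonneg ennreal_mult)
    finally show "Lp_norm M p (\<lambda>\<omega>. lam k * (\<Prod>s = 1..d. ?U k s \<omega>)) \<le> ennreal (\<bar>lam k\<bar> * (\<Prod>s = 1..d. ?Th k s))" .
  qed
  also have "\<dots> = ennreal (triple_Theta M \<xi> d p n m lam g)"
    unfolding triple_Theta_def by (intro sum_ennreal mult_nonneg_nonneg prod_nonneg Theta_nonneg ballI) auto
  finally show ?thesis .
qed

section \<open>The bound for each box and its supremum\<close>

theorem theorem5p1:
  fixes d :: nat and p :: real
    and X :: "nat \<Rightarrow> 'a measure" and P :: "'w measure"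
    and \<xi> :: "nat \<Rightarrow> nat \<Rightarrow> 'w \<Rightarrow> 'a"
    and f :: "(nat \<Rightarrow> 'a) \<Rightarrow> real"
    and lam :: "nat \<Rightarrow> (nat \<Rightarrow> nat) \<Rightarrow> real"
    and g :: "nat \<Rightarrow> nat \<Rightarrow> nat \<Rightarrow> 'a \<Rightarrow> real"
  assumes "d \<ge> 3" and "p \<ge> 2"
    and "\<And>s. s \<in> {1..d} \<Longrightarrow> prob_space (X s)"
    and "prob_space P"
    and "prob_space.indep_vars P (\<lambda>(i, s). X s) (\<lambda>(i, s). \<xi> i s) ({1..} \<times> {1..d})"
    and "\<And>i s. i \<ge> 1 \<Longrightarrow> s \<in> {1..d} \<Longrightarrow> distr P (X s) (\<xi> i s) = X s"
    and "f \<in> Lp_funs (PiM {1..d} X) p"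
    and "\<And>x. x \<in> space (PiM {1..d} X) \<Longrightarrow> 0 \<le> f x"
    and "\<And>M. M \<ge> 1 \<Longrightarrow> is_Z_plus X d p M f (lam M) (g M)"
  shows "(\<forall>n. (\<forall>s\<in>{1..d}. 1 \<le> n s) \<longrightarrow>
            Lp_norm P p (S_avg d \<xi> (index_box d n) f) \<le> W_box X P \<xi> d p f lam g n) \<and>
         (SUP n\<in>{n. \<forall>s\<in>{1..d}. 1 \<le> n s}. Lp_norm P p (S_avg d \<xi> (index_box d n) f))
            \<le> W_sup X P \<xi> d p f lam g"
proof -
  interpret prob_space P by fact
  note ind = assms(5) and law = assms(6)
  have box: "Lp_norm P p (S_avg d \<xi> (index_box d n) f) \<le> W_box X P \<xi> d p f lam g n"
    if n: "\<forall>s\<in>{1..d}. 1 \<le> n s" for n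
    unfolding W_box_def
  proof (rule INF_greatest)
    fix M :: nat assume "M \<in> {1..}"
    then have Z: "D_plus_rep X d p M (lam M) (g M)"
      "Lp_norm (PiM {1..d} X) p (\<lambda>x. f x - rep_fun d M (lam M) (g M) x) = Q_plus X d p M f"
      using assms(9)[of M] by (auto simp: is_Z_plus_def)
    let ?Z = "rep_fun d M (lam M) (g M)" and ?L = "index_box d n"
    have Zm: "?Z \<in> borel_measurable (PiM {1..d} X)"
      unfolding rep_fun_def
    proof (intro borel_measurable_sum borel_measurable_times borel_measurable_prod borel_measurable_const)
      fix k s assume k: "k \<in> {k. k \<in> multi_indices d \<and> N_max d k \<le> M}" and s: "s \<in> {1..d}"
      then have "g M s (k s) \<in> borel_measurable (X s)"
        using Z(1) multi_index_le[of k d M s] unfolding D_plus_rep_def Lp_funs_def by auto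
      then show "(\<lambda>x. g M s (k s) (x s)) \<in> borel_measurable (PiM {1..d} X)"
        using s by measurable
    qed
    have fm: "f \<in> borel_measurable (PiM {1..d} X)" using assms(7) by (simp add: Lp_funs_def)
    \<comment> \<open>The pairs \<open>(k s, s)\<close> are distinct for distinct
      \<open>s\<close>.\<close>
    have indT: "indep_vars X (\<lambda>s. \<xi> (k s) s) {1..d}" if "k \<in> ?L" for k
      using indep_vars_reindex[OF ind, of "\<lambda>s. (k s, s)" "{1..d}"] that
      by (auto simp: inj_on_def index_box_def PiE_iff)
    have T: "(\<lambda>\<omega>. \<lambda>s\<in>{1..d}. \<xi> (k s) s \<omega>) \<in> measurable P (PiM {1..d} X)" if "k \<in> ?L" for k
      using indT[OF that] by (intro measurable_restrict) (auto simp: indep_vars_def)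
    \<comment> \<open>\<open>assms(1)\<close> makes \<open>{1..d}\<close> non-empty, as
      \<open>distr_restrict_indep\<close> demands.\<close>
    have lawT: "distr P (PiM {1..d} X) (\<lambda>\<omega>. \<lambda>s\<in>{1..d}. \<xi> (k s) s \<omega>) = PiM {1..d} X" if "k \<in> ?L" for k
      using assms(1) that law by (intro distr_restrict_indep indT) (auto simp: index_box_def PiE_iff)
    have ne: "?L \<noteq> {}" using n by (auto simp: index_box_def PiE_eq_empty_iff)
    have Sm: "S_avg d \<xi> ?L h \<in> borel_measurable P" if h: "h \<in> borel_measurable (PiM {1..d} X)" for h
      unfolding S_avg_def
      by (intro borel_measurable_divide borel_measurable_sum measurable_compose[OF T h]
          borel_measurable_const)
    \<comment> \<open>\<open>S_avg\<close> is linear in the function, so the split of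
      \<open>f\<close> into \<open>?Z\<close> and remainder passes to the averages. The remainder
      costs exactly \<open>Q_plus\<close>, because \<open>?Z\<close> attains the infimum.\<close>
    have "Lp_norm P p (S_avg d \<xi> ?L f)
        = Lp_norm P p (\<lambda>\<omega>. S_avg d \<xi> ?L ?Z \<omega> + S_avg d \<xi> ?L (\<lambda>x. f x - ?Z x) \<omega>)"
      by (intro Lp_norm_cong) (simp add: S_avg_def sum_subtractf flip: add_divide_distrib)
    also have "\<dots> \<le> Lp_norm P p (S_avg d \<xi> ?L ?Z) + Lp_norm P p (S_avg d \<xi> ?L (\<lambda>x. f x - ?Z x))"
      using assms(2) fm Zm by (intro Lp_norm_add_le Sm borel_measurable_diff) auto
    also have "\<dots> \<le> ennreal (triple_Theta P \<xi> d p n M (lam M) (g M))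
        + Lp_norm (PiM {1..d} X) p (\<lambda>x. f x - ?Z x)"
      using assms(2) fm Zm ne n
      by (intro add_mono Lp_norm_S_avg_rep_fun_le[OF assms(2,3) ind law Z(1)] Lp_norm_S_avg_le T lawT) auto
    finally show "Lp_norm P p (S_avg d \<xi> ?L f)
        \<le> ennreal (triple_Theta P \<xi> d p n M (lam M) (g M)) + Q_plus X d p M f"
      unfolding Z(2) .
  qed
  then show ?thesis
    unfolding W_sup_def by (auto intro!: SUP_mono)
qed

end
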